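(* Let $G$ and $H$ be finite graphs, let $f:\mathbb{R}\to\mathbb{R}$ be a non-constant odd real-analytic function, and let $\varphi:V(G)\to V(H)$ be a generalized covering map. Then $\varphi$ induces an embedding $$\varphi^*: X_{H,f}\to X_{G,f},\qquad (\varphi^*(y))_i=y_{\varphi(i)}\quad (i\in V(G)),$$ of the set of equilibria up to symmetry of $H$ into the set of equilibria up to symmetry of $G$ (here points of $X_{H,f}$ and $X_{G,f}$ are represented by equilibria $y\in\mathbb{R}^{V(H)}$ and $\varphi^*(y)\in\mathbb{R}^{V(G)}$, modulo translational symmetry). In particular $\dim X_{G,f}\geq\dim X_{H,f}$.
   Context: Graphs are finite, simple and undirected; $N_G(i)$ is the set of neighbors of $i$ in $G$. A map is $d$-to-one ($d\ge1$ an integer) if every point of the codomain has exactly $d$ preimages in the domain. A surjection $\varphi:V(G)\to V(H)$ is a generalized covering map if for every vertex $i\in V(G)$ there is an integer $d_i\geq1$ such that the restriction $$\varphi|:N_G(i)\setminus\varphi^{-1}(\varphi(i))\to N_H(\varphi(i))$$ is well-defined (i.e. takes values in $N_H(\varphi(i))$) and $d_i$-to-one. For a graph $G$ with vertex set $V$, fix an arbitrary orientation of each edge and let $E\subseteq V\times V$ be the set of oriented edges. The incidence matrix $B:\mathbb{R}^E\to\mathbb{R}^V$ has entries $b_{i,(j,k)}=\delta_{ik}-\delta_{ij}$. Set $\mathrm{H}_0(G)=\mathrm{Ker}(B^{\mathsf T})$ and $\mathrm{H}_1(G)=\mathrm{Ker}(B)$. With $\mathbf{f}:\mathbb{R}^E\to\mathbb{R}^E$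 applying $f$ to each component, $X_{G,f}=\mathbf{f}^{-1}(\mathrm{H}_1(G))\cap\mathrm{H}_1(G)^\perp\subseteq\mathbb{R}^E$. The map $x\mapsto B^{\mathsf T}x$ identifies the equilibria $x\in\mathbb{R}^V$ of $\dot x_i=\sum_{j\in N_G(i)}f(x_j-x_i)$, modulo translations by $\mathrm{H}_0(G)$ (translational symmetry), with $X_{G,f}$. The set $X_{G,f}$ is real-analytic, and its dimension is the maximum dimension of a manifold contained in it. *)

theory Defs
  imports "HOL-Analysis.Analysis"
begin

section \<open>Graphs and generalized covering maps\<close>

record 'v ugraph =
  verts :: "'v set"
  edges :: "'v set set"

definition finite_simple_graph :: "'v ugraph \<Rightarrow> bool" where
  "finite_simple_graph G \<longleftrightarrow>
     finite (verts G) \<and> (\<forall>e\<in>edges G. e \<subseteq> verts G \<and> card e = 2)"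

definition nbrs :: "'v ugraph \<Rightarrow> 'v \<Rightarrow> 'v set" where
  "nbrs G i = {j. {i, j} \<in> edges G}"

text \<open>A neighborhood in \<open>H\<close> may be empty; then the condition says that every
  neighbor of \<open>i\<close> lies in the fiber of \<open>i\<close>.\<close>

definition generalized_covering_map ::
    "'v ugraph \<Rightarrow> 'w ugraph \<Rightarrow> ('v \<Rightarrow> 'w) \<Rightarrow> bool" where
  "generalized_covering_map G H \<phi> \<longleftrightarrow>
     \<phi> ` verts G = verts H \<and>
     (\<forall>i\<in>verts G. \<exists>d::nat. d \<ge> 1 \<and>
        \<phi> ` (nbrs G i - \<phi> -` {\<phi> i}) \<subseteq> nbrs H (\<phi> i) \<and>
        (\<forall>b\<in>nbrs H (\<phi> i). card {j \<in> nbrs G i - \<phi> -` {\<phi> i}. \<phi> j = b} = d))"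

definition orientation :: "'v ugraph \<Rightarrow> ('v \<times> 'v) set \<Rightarrow> bool" where
  "orientation G E \<longleftrightarrow>
     (\<forall>(i, j)\<in>E. {i, j} \<in> edges G) \<and>
     (\<forall>i j. {i, j} \<in> edges G \<longrightarrow> ((i, j) \<in> E \<longleftrightarrow> (j, i) \<notin> E))"

section \<open>Real-analytic maps and submanifolds\<close>

text \<open>For a finite index set \<open>I\<close>, the space of real \<open>I\<close>-tuples is represented by the
  extensional functions on \<open>I\<close>, i.e. the carrier of the topology \<open>powertop_real I\<close>.\<close>

abbreviation rspace :: "'i set \<Rightarrow> ('i \<Rightarrow> real) set" where
  "rspace I \<equiv> I \<rightarrow>\<^sub>E UNIV"

definition real_analytic :: "(real \<Rightarrow> real) \<Rightarrow> bool" where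
  "real_analytic f \<longleftrightarrow>
     (\<forall>a. \<exists>c r. r > 0 \<and> (\<forall>x. \<bar>x - a\<bar> < r \<longrightarrow> (\<lambda>n. c n * (x - a) ^ n) sums f x))"

text \<open>Expansion in a multivariate power series around \<open>a\<close>; the index set of the sum is
  the set of multi-indices \<open>I \<rightarrow> \<nat>\<close>.\<close>

definition real_analytic_at :: "'i set \<Rightarrow> (('i \<Rightarrow> real) \<Rightarrow> real) \<Rightarrow> ('i \<Rightarrow> real) \<Rightarrow> bool" where
  "real_analytic_at I g a \<longleftrightarrow>
     (\<exists>c r. r > 0 \<and>
        (\<forall>x\<in>rspace I. (\<forall>i\<in>I. \<bar>x i - a i\<bar> < r) \<longrightarrow>
           ((\<lambda>\<alpha>. c \<alpha> * (\<Prod>i\<in>I. (x i - a i) ^ \<alpha> i)) has_sum g x) (I \<rightarrow>\<^sub>E (UNIV::nat set))))"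

text \<open>A map from an arbitrary subset \<open>S\<close> of \<open>rspace I\<close> to \<open>rspace J\<close> is analytic if each of
  its components is, locally around each point of \<open>S\<close>, the restriction of an analytic
  function on an open set.\<close>

definition analytic_map :: "'i set \<Rightarrow> ('i \<Rightarrow> real) set \<Rightarrow> 'j set \<Rightarrow>
    (('i \<Rightarrow> real) \<Rightarrow> ('j \<Rightarrow> real)) \<Rightarrow> bool" where
  "analytic_map I S J F \<longleftrightarrow>
     (\<forall>a\<in>S. \<forall>j\<in>J. \<exists>U g. openin (powertop_real I) U \<and> a \<in> U \<and>
        (\<forall>x\<in>U. real_analytic_at I g x) \<and> (\<forall>x\<in>S \<inter> U. F x j = g x))"

definition analytic_embedding :: "'i set \<Rightarrow> ('i \<Rightarrow> real) set \<Rightarrow> 'j set \<Rightarrow> ('j \<Rightarrow> real) set \<Rightarrow>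
    (('i \<Rightarrow> real) \<Rightarrow> ('j \<Rightarrow> real)) \<Rightarrow> bool" where
  "analytic_embedding I S J T F \<longleftrightarrow>
     embedding_map (subtopology (powertop_real I) S) (subtopology (powertop_real J) T) F \<and>
     analytic_map I S J F \<and> analytic_map J (F ` S) I (inv_into S F)"

text \<open>\<open>M\<close> is an embedded \<open>k\<close>-dimensional submanifold: locally analytically isomorphic to
  open subsets of \<open>k\<close>-dimensional space.\<close>

definition submanifold :: "'i set \<Rightarrow> nat \<Rightarrow> ('i \<Rightarrow> real) set \<Rightarrow> bool" where
  "submanifold I k M \<longleftrightarrow>
     M \<subseteq> rspace I \<and>
     (\<forall>p\<in>M. \<exists>N U \<psi>. openin (subtopology (powertop_real I) M) N \<and> p \<in> N \<and>
        openin (powertop_real {..<k}) U \<and> analytic_embedding {..<k} U I N \<psi> \<and> \<psi> ` U = N)"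

text \<open>The empty manifold has every dimension and is excluded.  For finite \<open>I\<close> the
  dimensions are bounded by \<open>card I\<close>, so that the supremum is a maximum as soon as \<open>S\<close> is
  nonempty.\<close>

definition analytic_dim :: "'i set \<Rightarrow> ('i \<Rightarrow> real) set \<Rightarrow> enat" where
  "analytic_dim I S = (SUP k\<in>{k. \<exists>M. M \<subseteq> S \<and> M \<noteq> {} \<and> submanifold I k M}. enat k)"

section \<open>The incidence matrix and the set of equilibria up to symmetry\<close>

fun incidence :: "'v \<Rightarrow> 'v \<times> 'v \<Rightarrow> real" where
  "incidence i (j, k) = of_bool (i = k) - of_bool (i = j)"

definition inc_map :: "'v ugraph \<Rightarrow> ('v \<times> 'v) set \<Rightarrow> ('v \<times> 'v \<Rightarrow> real) \<Rightarrow> ('v \<Rightarrow> real)" where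
  "inc_map G E z = (\<lambda>i\<in>verts G. \<Sum>e\<in>E. incidence i e * z e)"

definition inc_transp :: "'v ugraph \<Rightarrow> ('v \<times> 'v) set \<Rightarrow> ('v \<Rightarrow> real) \<Rightarrow> ('v \<times> 'v \<Rightarrow> real)" where
  "inc_transp G E x = (\<lambda>e\<in>E. \<Sum>i\<in>verts G. incidence i e * x i)"

definition H1 :: "'v ugraph \<Rightarrow> ('v \<times> 'v) set \<Rightarrow> ('v \<times> 'v \<Rightarrow> real) set" where
  "H1 G E = {z \<in> rspace E. inc_map G E z = (\<lambda>i\<in>verts G. 0)}"

definition H1_perp :: "'v ugraph \<Rightarrow> ('v \<times> 'v) set \<Rightarrow> ('v \<times> 'v \<Rightarrow> real) set" where
  "H1_perp G E = {x \<in> rspace E. \<forall>z\<in>H1 G E. (\<Sum>e\<in>E. x e * z e) = 0}"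

definition equilibria_mod :: "'v ugraph \<Rightarrow> ('v \<times> 'v) set \<Rightarrow> (real \<Rightarrow> real) \<Rightarrow>
    ('v \<times> 'v \<Rightarrow> real) set" where
  "equilibria_mod G E f = {x \<in> rspace E. (\<lambda>e\<in>E. f (x e)) \<in> H1 G E} \<inter> H1_perp G E"

definition equilibria :: "'v ugraph \<Rightarrow> (real \<Rightarrow> real) \<Rightarrow> ('v \<Rightarrow> real) set" where
  "equilibria G f =
     {x \<in> rspace (verts G). \<forall>i\<in>verts G. (\<Sum>j\<in>nbrs G i. f (x j - x i)) = 0}"

definition pullback :: "'v ugraph \<Rightarrow> ('v \<Rightarrow> 'w) \<Rightarrow> ('w \<Rightarrow> real) \<Rightarrow> ('v \<Rightarrow> real)" where
  "pullback G \<phi> y = (\<lambda>i\<in>verts G. y (\<phi> i))"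

text \<open>\<open>\<Phi>\<close> is induced by \<open>pullback\<close> under the identification of equilibria modulo
  translations with \<open>equilibria_mod\<close> given by the transposed incidence matrices.\<close>

definition induced_by_pullback ::
    "'v ugraph \<Rightarrow> ('v \<times> 'v) set \<Rightarrow> 'w ugraph \<Rightarrow> ('w \<times> 'w) set \<Rightarrow> (real \<Rightarrow> real) \<Rightarrow> ('v \<Rightarrow> 'w) \<Rightarrow>
     (('w \<times> 'w \<Rightarrow> real) \<Rightarrow> ('v \<times> 'v \<Rightarrow> real)) \<Rightarrow> bool" where
  "induced_by_pullback G E\<^sub>G H E\<^sub>H f \<phi> \<Phi> \<longleftrightarrow>
     (\<forall>y\<in>equilibria H f. pullback G \<phi> y \<in> equilibria G f \<and>
        \<Phi> (inc_transp H E\<^sub>H y) = inc_transp G E\<^sub>G (pullback G \<phi> y))"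

end

theory Submission
  imports Defs
begin

text \<open>On oriented edges the induced map acts by coordinates: the value of \<open>\<phi>\<^sup>*(z)\<close> on an edge is
  \<open>0\<close> if \<open>\<phi>\<close> collapses the edge, and otherwise \<open>z\<close> on the image edge, up to a sign fixed by the
  orientations.  Every edge of \<open>H\<close> lifts to \<open>G\<close>, so choosing lifts gives a left inverse of the same
  form; both maps are linear, hence analytic.  The equilibrium condition is preserved because the
  sum over a neighborhood in \<open>G\<close> is \<open>d\<close> times the corresponding sum in \<open>H\<close>.  Orthogonality to the
  cycles is preserved because the transposed map sends cycles of \<open>G\<close> to cycles of \<open>H\<close>.\<close>

section \<open>Analytic embeddings by signed coordinates\<close>

text \<open>Every output coordinate is a scalar multiple of one input coordinate. Where
  \<open>s j = 0\<close> the index \<open>t j\<close> is a mere default and may lie outside the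
  domain; collapsed edges will be of this kind.\<close>

definition coord_map :: "'j set \<Rightarrow> ('j \<Rightarrow> real) \<Rightarrow> ('j \<Rightarrow> 'i) \<Rightarrow> ('i \<Rightarrow> real) \<Rightarrow> ('j \<Rightarrow> real)" where
  "coord_map J s t x = (\<lambda>j\<in>J. s j * x (t j))"

lemma coord_map_in_rspace: "coord_map J s t x \<in> rspace J"
  by (simp add: coord_map_def)

lemma coord_map_image_subset: "coord_map J s t ` A \<subseteq> rspace J"
  by (rule image_subsetI) (rule coord_map_in_rspace)

lemma continuous_map_coord_map:
  assumes "\<And>j. j \<in> J \<Longrightarrow> s j \<noteq> 0 \<Longrightarrow> t j \<in> I"
  shows "continuous_map (powertop_real I) (powertop_real J) (coord_map J s t)"
proof -
  have "continuous_map (powertop_real I) euclideanreal (\<lambda>x. s j * x (t j))" if "j \<in> J" for j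
  proof (cases "s j = 0")
    case False
    then have "continuous_map (powertop_real I) euclideanreal (\<lambda>x. x (t j))"
      by (intro continuous_map_product_projection assms that)
    then show ?thesis
      by (intro continuous_map_real_mult) auto
  qed auto
  then show ?thesis
    by (auto simp: continuous_map_componentwise coord_map_def)
qed

section \<open>Power series: constants, coordinates, substitution of signed coordinates\<close>

lemma real_analytic_at_const:
  assumes "finite I"
  shows "real_analytic_at I (\<lambda>x. b) a"
proof -
  define c where "c \<alpha> = (if \<alpha> = (\<lambda>i\<in>I. 0::nat) then b else 0)" for \<alpha>
  have "((\<lambda>\<alpha>. c \<alpha> * (\<Prod>i\<in>I. (x i - a i) ^ \<alpha> i)) has_sum b) (I \<rightarrow>\<^sub>E (UNIV::nat set))" for x
    by (rule has_sum_finite_neutralI[of "{\<lambda>i\<in>I. 0}"]) (auto simp: c_def)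
  then show ?thesis
    unfolding real_analytic_at_def by (intro exI[of _ c] exI[of _ 1]) auto
qed

text \<open>Since \<open>x i = a i + (x i - a i)\<close>, only the zero multi-index and the unit
  multi-index of \<open>i\<close> contribute.\<close>

lemma real_analytic_at_coordinate:
  assumes "finite I" "i \<in> I"
  shows "real_analytic_at I (\<lambda>x. x i) a"
proof -
  define \<alpha>0 where "\<alpha>0 = (\<lambda>j\<in>I. 0::nat)"
  define \<alpha>1 where "\<alpha>1 = (\<lambda>j\<in>I. if j = i then 1 else 0::nat)"
  define c where "c \<alpha> = (if \<alpha> = \<alpha>0 then a i else if \<alpha> = \<alpha>1 then 1 else 0)" for \<alpha>
  have "\<alpha>0 i \<noteq> \<alpha>1 i"
    using assms by (simp add: \<alpha>0_def \<alpha>1_def)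
  then have ne: "\<alpha>0 \<noteq> \<alpha>1"
    by auto
  have p0: "(\<Prod>j\<in>I. (x j - a j) ^ \<alpha>0 j) = 1" for x
    by (simp add: \<alpha>0_def)
  have p1: "(\<Prod>j\<in>I. (x j - a j) ^ \<alpha>1 j) = x i - a i" for x
  proof -
    have "(\<Prod>j\<in>I. (x j - a j) ^ \<alpha>1 j) = (\<Prod>j\<in>I. if j = i then x j - a j else 1)"
      by (intro prod.cong) (auto simp: \<alpha>1_def)
    then show ?thesis
      using assms by simp
  qed
  have "((\<lambda>\<alpha>. c \<alpha> * (\<Prod>j\<in>I. (x j - a j) ^ \<alpha> j)) has_sum x i) (I \<rightarrow>\<^sub>E (UNIV::nat set))" for x
    by (rule has_sum_finite_neutralI[of "{\<alpha>0, \<alpha>1}"])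
       (use ne in \<open>auto simp: c_def p0 p1\<close>, auto simp: \<alpha>0_def \<alpha>1_def)
  then show ?thesis
    unfolding real_analytic_at_def by (intro exI[of _ c] exI[of _ 1]) auto
qed

lemma real_analytic_at_cmult:
  assumes "real_analytic_at I g a"
  shows "real_analytic_at I (\<lambda>x. b * g x) a"
proof -
  obtain c r where r: "r > 0" and
    sums: "\<And>x. x \<in> rspace I \<Longrightarrow> \<forall>i\<in>I. \<bar>x i - a i\<bar> < r \<Longrightarrow>
        ((\<lambda>\<alpha>. c \<alpha> * (\<Prod>i\<in>I. (x i - a i) ^ \<alpha> i)) has_sum g x) (I \<rightarrow>\<^sub>E (UNIV::nat set))"
    using assms unfolding real_analytic_at_def by blast
  show ?thesis
    unfolding real_analytic_at_def
    using has_sum_cmult_right[OF sums, of _ b] r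
    by (intro exI[of _ "\<lambda>\<alpha>. b * c \<alpha>"] exI[of _ r]) (auto simp: mult.assoc)
qed

text \<open>The substitution only renames variables, injectively, and changes signs. A power series
  therefore stays a power series with transported coefficients, and signs of modulus 1 keep the same
  radius \<open>r\<close>.\<close>

lemma real_analytic_at_compose_coord_map:
  assumes "finite J" and inj: "inj_on t I" and sub: "t ` I \<subseteq> J" and s: "\<And>i. i \<in> I \<Longrightarrow> \<bar>s i\<bar> = 1"
    and "real_analytic_at I g (coord_map I s t a)"
  shows "real_analytic_at J (\<lambda>x. g (coord_map I s t x)) a"
proof -
  let ?L = "coord_map I s t"
  obtain c r where r: "r > 0" and
    sums: "\<And>y. y \<in> rspace I \<Longrightarrow> \<forall>i\<in>I. \<bar>y i - ?L a i\<bar> < r \<Longrightarrow>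
        ((\<lambda>\<alpha>. c \<alpha> * (\<Prod>i\<in>I. (y i - ?L a i) ^ \<alpha> i)) has_sum g y) (I \<rightarrow>\<^sub>E (UNIV::nat set))"
    using assms(5) unfolding real_analytic_at_def by blast
  \<comment> \<open>\<open>pull\<close> and \<open>push\<close> transport exponents along
    \<open>t\<close>. They are mutually inverse between the multi-indices on \<open>I\<close> and
    the set \<open>T\<close> of multi-indices on \<open>J\<close> that vanish off the image of
    \<open>t\<close>.\<close>
  define pull where "pull \<beta> = (\<lambda>i\<in>I. \<beta> (t i) :: nat)" for \<beta>
  define push where "push \<alpha> = (\<lambda>j\<in>J. if j \<in> t ` I then \<alpha> (inv_into I t j) else 0 :: nat)" for \<alpha>
  define T where "T = {\<beta> \<in> J \<rightarrow>\<^sub>E (UNIV::nat set). \<forall>j\<in>J - t ` I. \<beta> j = 0}"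
  \<comment> \<open>The powers of the signs are absorbed into the coefficients; monomials with a
    variable outside the image of \<open>t\<close> get coefficient 0.\<close>
  define c' where "c' \<beta> = (if \<beta> \<in> T then c (pull \<beta>) * (\<Prod>i\<in>I. s i ^ \<beta> (t i)) else 0)" for \<beta>
  have pull: "pull \<beta> \<in> I \<rightarrow>\<^sub>E UNIV" for \<beta>
    by (simp add: pull_def)
  have push: "push \<alpha> \<in> T" for \<alpha>
    by (auto simp: push_def T_def)
  have pull_push: "pull (push \<alpha>) = \<alpha>" if "\<alpha> \<in> I \<rightarrow>\<^sub>E UNIV" for \<alpha>
  proof (rule PiE_ext[OF pull that])
    show "pull (push \<alpha>) i = \<alpha> i" if "i \<in> I" for i
      using that sub inj by (auto simp: pull_def push_def)
  qed
  have push_pull: "push (pull \<beta>) = \<beta>" if "\<beta> \<in> T" for \<beta>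
  proof (rule PiE_ext[of _ J "\<lambda>_. UNIV"])
    show "push (pull \<beta>) j = \<beta> j" if "j \<in> J" for j
      using that \<open>\<beta> \<in> T\<close> inj by (auto simp: pull_def push_def T_def)
  qed (use that push in \<open>auto simp: T_def\<close>)
  have "((\<lambda>\<beta>. c' \<beta> * (\<Prod>j\<in>J. (x j - a j) ^ \<beta> j)) has_sum g (?L x)) (J \<rightarrow>\<^sub>E (UNIV::nat set))"
    if close: "\<forall>j\<in>J. \<bar>x j - a j\<bar> < r" for x
  proof -
    have diff: "?L x i - ?L a i = s i * (x (t i) - a (t i))" if "i \<in> I" for i
      using that by (simp add: coord_map_def algebra_simps)
    have "\<forall>i\<in>I. \<bar>?L x i - ?L a i\<bar> < r"
      using close sub by (auto simp: diff s abs_mult)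
    then have sum_I: "((\<lambda>\<alpha>. c \<alpha> * (\<Prod>i\<in>I. (?L x i - ?L a i) ^ \<alpha> i)) has_sum g (?L x))
        (I \<rightarrow>\<^sub>E (UNIV::nat set))"
      by (intro sums coord_map_in_rspace)
    have term_eq: "c' \<beta> * (\<Prod>j\<in>J. (x j - a j) ^ \<beta> j) =
        c (pull \<beta>) * (\<Prod>i\<in>I. (?L x i - ?L a i) ^ pull \<beta> i)" if "\<beta> \<in> T" for \<beta>
    proof -
      have "(\<Prod>j\<in>J. (x j - a j) ^ \<beta> j) = (\<Prod>j\<in>t ` I. (x j - a j) ^ \<beta> j)"
        using that sub by (intro prod.mono_neutral_right \<open>finite J\<close>) (auto simp: T_def)
      also have "\<dots> = (\<Prod>i\<in>I. (x (t i) - a (t i)) ^ \<beta> (t i))"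
        by (simp add: prod.reindex inj)
      finally have "c' \<beta> * (\<Prod>j\<in>J. (x j - a j) ^ \<beta> j) =
          c (pull \<beta>) * (\<Prod>i\<in>I. (s i * (x (t i) - a (t i))) ^ \<beta> (t i))"
        using that by (simp add: c'_def power_mult_distrib prod.distrib)
      also have "(\<Prod>i\<in>I. (s i * (x (t i) - a (t i))) ^ \<beta> (t i)) =
          (\<Prod>i\<in>I. (?L x i - ?L a i) ^ pull \<beta> i)"
        by (intro prod.cong) (auto simp: diff pull_def)
      finally show ?thesis .
    qed
    have "((\<lambda>\<beta>. c' \<beta> * (\<Prod>j\<in>J. (x j - a j) ^ \<beta> j)) has_sum g (?L x)) T"
      using sum_I
      by (subst (asm) has_sum_reindex_bij_witness[where i = pull and j = push and T = T
            and h = "\<lambda>\<beta>. c' \<beta> * (\<Prod>j\<in>J. (x j - a j) ^ \<beta> j)"])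
         (auto simp: push_pull pull_push pull push term_eq simp del: PiE_UNIV_domain)
    then show ?thesis
      by (subst (asm) has_sum_cong_neutral) (auto simp: c'_def, auto simp: T_def)
  qed
  then show ?thesis
    unfolding real_analytic_at_def using r by blast
qed

section \<open>Analytic maps and composition with signed coordinates\<close>

lemma analytic_mapE:
  assumes "analytic_map I S J F" "a \<in> S" "j \<in> J"
  obtains U g where "openin (powertop_real I) U" "a \<in> U" "\<forall>x\<in>U. real_analytic_at I g x"
    "\<forall>x\<in>S \<inter> U. F x j = g x"
proof -
  have "\<exists>U g. openin (powertop_real I) U \<and> a \<in> U \<and> (\<forall>x\<in>U. real_analytic_at I g x) \<and>
      (\<forall>x\<in>S \<inter> U. F x j = g x)"
    by (rule bspec[OF bspec[OF assms(1)[unfolded analytic_map_def] assms(2)] assms(3)])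
  then show ?thesis
    using that by (elim exE conjE)
qed

lemma analytic_map_cong:
  assumes "analytic_map I S J F" "\<And>x. x \<in> S \<Longrightarrow> F x = F' x"
  shows "analytic_map I S J F'"
  using assms unfolding analytic_map_def by (metis IntD1)

lemma analytic_map_id:
  assumes "finite I" "S \<subseteq> rspace I"
  shows "analytic_map I S I id"
  unfolding analytic_map_def
proof (intro ballI)
  fix a i assume "a \<in> S" "i \<in> I"
  then show "\<exists>U g. openin (powertop_real I) U \<and> a \<in> U \<and> (\<forall>x\<in>U. real_analytic_at I g x) \<and>
      (\<forall>x\<in>S \<inter> U. id x i = g x)"
    using assms real_analytic_at_coordinate[OF assms(1)]
    by (intro exI[of _ "rspace I"] exI[of _ "\<lambda>x. x i"])
       (auto intro: openin_topspace[of "powertop_real I", simplified])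
qed

text \<open>Each component of the composite is zero or a multiple of a single component of
  \<open>F\<close>, so the local extension of that component can be reused on the same
  neighborhood.\<close>

lemma analytic_map_coord_map_after:
  assumes "analytic_map I S J F" and "finite I" "S \<subseteq> rspace I"
    and t: "\<And>k. k \<in> K \<Longrightarrow> s k \<noteq> 0 \<Longrightarrow> t k \<in> J"
  shows "analytic_map I S K (coord_map K s t \<circ> F)"
  unfolding analytic_map_def
proof (intro ballI)
  fix a k assume a: "a \<in> S" and k: "k \<in> K"
  show "\<exists>U g. openin (powertop_real I) U \<and> a \<in> U \<and> (\<forall>x\<in>U. real_analytic_at I g x) \<and>
      (\<forall>x\<in>S \<inter> U. (coord_map K s t \<circ> F) x k = g x)"
  proof (cases "s k = 0")
    case True
    then show ?thesis
      using assms a k real_analytic_at_const[OF \<open>finite I\<close>, of 0]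
      by (intro exI[of _ "rspace I"] exI[of _ "\<lambda>x. 0"])
         (auto simp: coord_map_def intro: openin_topspace[of "powertop_real I", simplified])
  next
    case False
    obtain U g where U: "openin (powertop_real I) U" "a \<in> U" "\<forall>x\<in>U. real_analytic_at I g x"
      "\<forall>x\<in>S \<inter> U. F x (t k) = g x"
      by (rule analytic_mapE[OF assms(1) a t[OF k False]])
    then show ?thesis
      using k real_analytic_at_cmult[of I g _ "s k"]
      by (intro exI[of _ U] exI[of _ "\<lambda>x. s k * g x"]) (auto simp: coord_map_def)
  qed
qed

text \<open>A local extension of \<open>F\<close> on \<open>U\<close> is pulled back to the preimage
  of \<open>U\<close>, which is open by continuity, and its power series are transformed by
  substitution.\<close>

lemma analytic_map_coord_map_before:
  assumes "analytic_map I S K F" and "finite J" and inj: "inj_on t I" and sub: "t ` I \<subseteq> J"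
    and s: "\<And>i. i \<in> I \<Longrightarrow> \<bar>s i\<bar> = 1"
    and S': "S' \<subseteq> rspace J" "coord_map I s t ` S' \<subseteq> S"
  shows "analytic_map J S' K (F \<circ> coord_map I s t)"
  unfolding analytic_map_def
proof (intro ballI)
  fix a k assume a: "a \<in> S'" and k: "k \<in> K"
  let ?L = "coord_map I s t"
  obtain U g where U: "openin (powertop_real I) U" "?L a \<in> U"
    "\<forall>x\<in>U. real_analytic_at I g x" "\<forall>x\<in>S \<inter> U. F x k = g x"
  proof -
    have "?L a \<in> S"
      using a S' by auto
    then show ?thesis
      using analytic_mapE[OF assms(1) _ k] that by blast
  qed
  define V where "V = {x \<in> rspace J. ?L x \<in> U}"
  have cont: "continuous_map (powertop_real J) (powertop_real I) ?L"
    by (rule continuous_map_coord_map) (use sub in auto)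
  from openin_continuous_map_preimage[OF cont U(1)] have "openin (powertop_real J) V"
    by (simp add: V_def)
  moreover have "real_analytic_at J (\<lambda>x. g (?L x)) x" if "x \<in> V" for x
    using real_analytic_at_compose_coord_map[of J t I s g x] \<open>finite J\<close> inj sub s U that
    by (auto simp: V_def)
  ultimately show "\<exists>U g. openin (powertop_real J) U \<and> a \<in> U \<and> (\<forall>x\<in>U. real_analytic_at J g x) \<and>
      (\<forall>x\<in>S' \<inter> U. (F \<circ> ?L) x k = g x)"
    using a U S' by (intro exI[of _ V] exI[of _ "\<lambda>x. g (?L x)"]) (auto simp: V_def)
qed

section \<open>Analytic embeddings\<close>

lemma analytic_embedding_id:
  assumes "finite I" "S \<subseteq> rspace I"
  shows "analytic_embedding I S I S id"
proof -
  have "inv_into S id x = id x" if "x \<in> S" for x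
    using that by (metis id_apply inj_on_id inv_into_f_f)
  then have "analytic_map I (id ` S) I (inv_into S id)"
    using analytic_map_cong[OF analytic_map_id[OF assms], of "inv_into S id"] by simp
  moreover have "embedding_map (subtopology (powertop_real I) S) (subtopology (powertop_real I) S) id"
    using homeomorphic_map_id surjective_embedding_map by blast
  ultimately show ?thesis
    using analytic_map_id[OF assms] by (simp add: analytic_embedding_def)
qed

lemma analytic_embedding_codomain:
  assumes "analytic_embedding I S J T F" "T \<subseteq> T'"
  shows "analytic_embedding I S J T' F"
  using assms unfolding analytic_embedding_def embedding_map_in_subtopology by auto

lemma analytic_embedding_image_subset:
  assumes "analytic_embedding I S J T F" "S \<subseteq> rspace I"
  shows "F ` S \<subseteq> T"
proof -
  have "topspace (subtopology (powertop_real I) S) = S"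
    using assms(2) by auto
  then show ?thesis
    using assms(1) by (simp add: analytic_embedding_def embedding_map_in_subtopology)
qed

lemma analytic_embedding_inj_on:
  assumes "analytic_embedding I S J T F" "S \<subseteq> rspace I"
  shows "inj_on F S"
  using assms homeomorphic_imp_injective_map
  by (fastforce simp: analytic_embedding_def embedding_map_def inf.absorb2)

text \<open>The last conjunct makes every input coordinate visible, up to sign, in some output
  coordinate; this gives injectivity. Nonzero signs are their own inverses, so a left inverse can
  use the same signs.\<close>

definition covering_coords :: "'i set \<Rightarrow> 'j set \<Rightarrow> ('j \<Rightarrow> real) \<Rightarrow> ('j \<Rightarrow> 'i) \<Rightarrow> bool" where
  "covering_coords I J s t \<longleftrightarrow>
     (\<forall>j\<in>J. s j \<in> {-1, 0, 1} \<and> (s j \<noteq> 0 \<longrightarrow> t j \<in> I)) \<and> (\<forall>i\<in>I. \<exists>j\<in>J. s j \<noteq> 0 \<and> t j = i)"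

text \<open>Choose for each \<open>i\<close> an output index that shows \<open>x i\<close> up to
  sign and multiply by that sign again. The choice \<open>t'\<close> is injective because
  \<open>t\<close> undoes it. The conclusions are those that substitution into power series
  requires.\<close>

lemma covering_coords_left_inverse:
  assumes "covering_coords I J s t"
  obtains s' t' where "inj_on t' I" "t' ` I \<subseteq> J" "\<And>i. i \<in> I \<Longrightarrow> \<bar>s' i\<bar> = (1::real)"
    "\<And>x. x \<in> rspace I \<Longrightarrow> coord_map I s' t' (coord_map J s t x) = x"
proof -
  have "\<forall>i\<in>I. \<exists>j. j \<in> J \<and> s j \<noteq> 0 \<and> t j = i"
    using assms by (auto simp: covering_coords_def)
  then obtain t' where t': "\<And>i. i \<in> I \<Longrightarrow> t' i \<in> J \<and> s (t' i) \<noteq> 0 \<and> t (t' i) = i"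
    by metis
  then have sgn: "s (t' i) = 1 \<or> s (t' i) = -1" if "i \<in> I" for i
    using assms that by (fastforce simp: covering_coords_def)
  show ?thesis
  proof
    show "inj_on t' I"
      by (metis inj_onI t')
    show "t' ` I \<subseteq> J"
      using t' by auto
    show "\<bar>s (t' i)\<bar> = 1" if "i \<in> I" for i
      using sgn[OF that] by auto
    show "coord_map I (\<lambda>i. s (t' i)) t' (coord_map J s t x) = x" if "x \<in> rspace I" for x
    proof (rule PiE_ext[OF coord_map_in_rspace that])
      show "coord_map I (\<lambda>i. s (t' i)) t' (coord_map J s t x) i = x i" if "i \<in> I" for i
        using sgn[OF that] t'[OF that] that by (auto simp: coord_map_def)
    qed
  qed
qed

text \<open>A continuous map with a continuous left inverse is a section, hence a topological
  embedding.\<close>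

lemma embedding_map_coord_map:
  assumes "covering_coords I J s t"
  shows "embedding_map (powertop_real I) (powertop_real J) (coord_map J s t)"
proof -
  obtain s' t' where "t' ` I \<subseteq> J"
    and "\<And>x. x \<in> rspace I \<Longrightarrow> coord_map I s' t' (coord_map J s t x) = x"
    using covering_coords_left_inverse[OF assms] by metis
  then have "retraction_maps (powertop_real J) (powertop_real I) (coord_map I s' t') (coord_map J s t)"
    using assms unfolding retraction_maps_def covering_coords_def
    by (auto intro!: continuous_map_coord_map)
  then show ?thesis
    by (intro section_imp_embedding_map) (auto simp: section_map_def)
qed

lemma homeomorphic_map_embedding_map_image:
  assumes "embedding_map X Y f" "S \<subseteq> topspace X"
  shows "homeomorphic_map (subtopology X S) (subtopology Y (f ` S)) f"
proof -
  let ?Y = "subtopology Y (f ` topspace X)"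
  have hom: "homeomorphic_map X ?Y f"
    using assms(1) by (simp add: embedding_map_def)
  then have "f ` topspace X = topspace ?Y"
    by (rule homeomorphic_imp_surjective_map)
  then have "f ` (topspace X \<inter> S) = topspace ?Y \<inter> f ` S"
    using assms(2) by (metis image_mono inf.absorb2)
  then have "homeomorphic_map (subtopology X S) (subtopology ?Y (f ` S)) f"
    by (rule homeomorphic_map_subtopologies[OF hom])
  moreover have "subtopology ?Y (f ` S) = subtopology Y (f ` S)"
    using assms(2) by (simp add: subtopology_subtopology inf.absorb2 image_mono)
  ultimately show ?thesis
    by simp
qed

lemma homeomorphic_map_coord_map:
  assumes "covering_coords I J s t" "S \<subseteq> rspace I"
  shows "homeomorphic_map (subtopology (powertop_real I) S)
    (subtopology (powertop_real J) (coord_map J s t ` S)) (coord_map J s t)"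
  by (rule homeomorphic_map_embedding_map_image[OF embedding_map_coord_map[OF assms(1)]])
     (use assms(2) in simp)

text \<open>The inverse of the composite is the inverse of \<open>F\<close> after a signed
  coordinate map, so both directions are analytic by the composition lemmas. The general
  \<open>F\<close> serves two cases: the identity, for the map itself, and charts, for images of
  submanifolds.\<close>

lemma analytic_embedding_coord_map:
  assumes emb: "analytic_embedding I S J T F" and sub: "S \<subseteq> rspace I" "T \<subseteq> rspace J"
    and fin: "finite I" "finite K"
    and cov: "covering_coords J K s t"
  shows "analytic_embedding I S K (coord_map K s t ` T) (coord_map K s t \<circ> F)"
proof -
  let ?L = "coord_map K s t"
  obtain s' t' where t': "inj_on t' J" "t' ` J \<subseteq> K" and s': "\<And>j. j \<in> J \<Longrightarrow> \<bar>s' j\<bar> = (1::real)"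
    and inv: "\<And>x. x \<in> rspace J \<Longrightarrow> coord_map J s' t' (?L x) = x"
    by (rule covering_coords_left_inverse[OF cov]) (rule that)
  have FS: "F ` S \<subseteq> T" and inj: "inj_on F S"
    using analytic_embedding_image_subset analytic_embedding_inj_on emb sub by blast+
  have "embedding_map (subtopology (powertop_real J) T)
      (subtopology (powertop_real K) (?L ` T)) ?L"
    using homeomorphic_map_coord_map[OF cov sub(2)] surjective_embedding_map by blast
  then have "embedding_map (subtopology (powertop_real I) S)
      (subtopology (powertop_real K) (?L ` T)) (?L \<circ> F)"
    using emb embedding_map_compose unfolding analytic_embedding_def by blast
  moreover have "analytic_map I S K (?L \<circ> F)"
    using emb cov by (intro analytic_map_coord_map_after[OF _ fin(1) sub(1)])
      (auto simp: analytic_embedding_def covering_coords_def)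
  moreover have "analytic_map K ((?L \<circ> F) ` S) I (inv_into S (?L \<circ> F))"
  \<comment> \<open>Analyticity is shown for the explicit inverse, which agrees on the image with
    the chosen \<open>inv_into\<close> because the composite is injective.\<close>
  proof (rule analytic_map_cong)
    show "analytic_map K ((?L \<circ> F) ` S) I (inv_into S F \<circ> coord_map J s' t')"
    proof (rule analytic_map_coord_map_before[OF _ fin(2) t' s'])
      show "analytic_map J (F ` S) I (inv_into S F)"
        using emb by (simp add: analytic_embedding_def)
      show "(?L \<circ> F) ` S \<subseteq> rspace K"
        by (simp only: image_comp[symmetric] coord_map_image_subset)
      have "coord_map J s' t' (?L (F x)) = F x" if "x \<in> S" for x
        by (rule inv) (use that FS sub in blast)
      then show "coord_map J s' t' ` (?L \<circ> F) ` S \<subseteq> F ` S"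
        by (simp add: image_subset_iff)
    qed
  next
    fix y assume "y \<in> (?L \<circ> F) ` S"
    then obtain x where x: "x \<in> S" "y = ?L (F x)"
      by auto
    have left_inv: "coord_map J s' t' (?L (F x)) = F x" if "x \<in> S" for x
      by (rule inv) (use that FS sub in blast)
    then have "inj_on ?L (F ` S)"
      by (intro inj_on_inverseI[of _ "coord_map J s' t'"]) auto
    then have "inj_on (?L \<circ> F) S"
      by (rule comp_inj_on[OF inj])
    then have "inv_into S (?L \<circ> F) y = x"
      using x inv_into_f_f by fastforce
    then show "(inv_into S F \<circ> coord_map J s' t') y = inv_into S (?L \<circ> F) y"
      using x left_inv inj by simp
  qed
  ultimately show ?thesis
    by (simp add: analytic_embedding_def)
qed

section \<open>Images of submanifolds and comparison of dimensions\<close>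

text \<open>Charts of \<open>M\<close> followed by the coordinate map are charts of the image with
  the same parameter domains; relative openness passes over because the map is a homeomorphism onto
  its image.\<close>

lemma submanifold_coord_map_image:
  assumes M: "submanifold I k M" and fin: "finite J"
    and cov: "covering_coords I J s t"
  shows "submanifold J k (coord_map J s t ` M)"
  unfolding submanifold_def
proof (intro conjI ballI)
  let ?L = "coord_map J s t"
  show "?L ` M \<subseteq> rspace J"
    by (rule coord_map_image_subset)
  have sub: "M \<subseteq> rspace I"
    using M by (simp add: submanifold_def)
  fix q assume "q \<in> ?L ` M"
  then obtain p where p: "p \<in> M" "q = ?L p"
    by auto
  then obtain N U \<psi> where N: "openin (subtopology (powertop_real I) M) N" "p \<in> N"
    and U: "openin (powertop_real {..<k}) U" and emb: "analytic_embedding {..<k} U I N \<psi>"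
    and im: "\<psi> ` U = N"
    using M unfolding submanifold_def by meson
  have NM: "N \<subseteq> M"
    using N(1) openin_imp_subset by blast
  have "U \<subseteq> rspace {..<k}"
    using openin_subset[OF U] by simp
  then have "analytic_embedding {..<k} U J (?L ` N) (?L \<circ> \<psi>)"
    using NM sub by (intro analytic_embedding_coord_map[OF emb _ _ _ fin cov]) auto
  moreover have "openin (subtopology (powertop_real J) (?L ` M)) (?L ` N)"
    using homeomorphic_map_coord_map[OF cov sub] N(1) homeomorphic_map_openness_eq by blast
  moreover have "q \<in> ?L ` N"
    using p N by blast
  moreover have "(?L \<circ> \<psi>) ` U = ?L ` N"
    using im by (simp only: image_comp[symmetric])
  ultimately show "\<exists>N' U' \<psi>'. openin (subtopology (powertop_real J) (?L ` M)) N' \<and> q \<in> N' \<and>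
      openin (powertop_real {..<k}) U' \<and> analytic_embedding {..<k} U' J N' \<psi>' \<and> \<psi>' ` U' = N'"
    using U by (intro exI conjI)
qed

text \<open>A nonempty manifold inside \<open>S\<close> is carried to one of the same dimension
  inside \<open>T\<close>, so the dimensions occurring for \<open>S\<close> also occur for
  \<open>T\<close>.\<close>

lemma analytic_dim_coord_map_le:
  assumes "finite J" "covering_coords I J s t" "coord_map J s t ` S \<subseteq> T"
  shows "analytic_dim I S \<le> analytic_dim J T"
proof -
  have "\<exists>M'\<subseteq>T. M' \<noteq> {} \<and> submanifold J k M'" if "M \<subseteq> S" "M \<noteq> {}" "submanifold I k M" for k M
    using that assms(3) submanifold_coord_map_image[OF that(3) assms(1,2)]
    by (intro exI[of _ "coord_map J s t ` M"]) auto
  then show ?thesis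
    unfolding analytic_dim_def by (intro SUP_subset_mono) auto
qed

section \<open>Pullback of edge values along a generalized covering map\<close>

text \<open>The antisymmetric extension of edge values to all ordered pairs, zero on non-edges. It
  hides the orientation, so that sign distinctions disappear from later sums.\<close>

definition skew :: "('v \<times> 'v) set \<Rightarrow> ('v \<times> 'v \<Rightarrow> real) \<Rightarrow> 'v \<Rightarrow> 'v \<Rightarrow> real" where
  "skew E z p q = (if (p, q) \<in> E then z (p, q) else if (q, p) \<in> E then - z (q, p) else 0)"

lemma orientation_edge: "orientation G E \<Longrightarrow> (p, q) \<in> E \<Longrightarrow> {p, q} \<in> edges G"
  by (auto simp: orientation_def)

lemma orientation_asym: "orientation G E \<Longrightarrow> (p, q) \<in> E \<Longrightarrow> (q, p) \<notin> E"
  unfolding orientation_def by blast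

lemma orientation_total: "orientation G E \<Longrightarrow> {p, q} \<in> edges G \<Longrightarrow> (p, q) \<in> E \<or> (q, p) \<in> E"
  unfolding orientation_def by blast

lemma skew_antisym: "orientation G E \<Longrightarrow> skew E z p q = - skew E z q p"
  using orientation_asym[of G E p q] by (auto simp: skew_def)

lemma skew_refl: "orientation G E \<Longrightarrow> skew E z p p = 0"
  using skew_antisym[of G E z p p] by simp

text \<open>Oddness handles reversed edges and, through \<open>f 0 = 0\<close>, the pairs that are
  not edges.\<close>

lemma skew_odd:
  assumes "\<forall>x. f (- x) = - f x"
  shows "skew E (\<lambda>e\<in>E. f (z e)) p q = f (skew E z p q)"
proof -
  have "f 0 = 0"
    using spec[OF assms, of 0] by simp
  then show ?thesis
    using assms by (simp add: skew_def)
qed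

text \<open>\<open>skew\<close> is linear in the edge values. Expanding in indicators of edges
  exhibits matrix entries, from which the transpose of the pullback is formed.\<close>

lemma skew_expand:
  assumes "finite E"
  shows "skew E z p q = (\<Sum>e\<in>E. z e * skew E (\<lambda>e'. of_bool (e' = e)) p q)"
proof -
  have "(\<Sum>e\<in>E. z e * of_bool (e' = e)) = z e'" if "e' \<in> E" for e'
    using assms that by (simp add: of_bool_def if_distrib cong: if_cong)
  then show ?thesis
    by (simp add: skew_def sum_negf)
qed

lemma edge_verts:
  assumes "finite_simple_graph G" "{p, q} \<in> edges G"
  shows "p \<in> verts G" "q \<in> verts G" "p \<noteq> q"
  using assms by (force simp: finite_simple_graph_def)+

lemma finite_orientation:
  assumes "finite_simple_graph G" "orientation G E"
  shows "finite E"
proof (rule finite_subset)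
  show "E \<subseteq> verts G \<times> verts G"
    using edge_verts(1,2)[OF assms(1) orientation_edge[OF assms(2)]] by auto
  show "finite (verts G \<times> verts G)"
    using assms(1) by (simp add: finite_simple_graph_def)
qed

lemma finite_nbrs:
  assumes "finite_simple_graph G"
  shows "finite (nbrs G i)"
proof (rule finite_subset)
  show "nbrs G i \<subseteq> verts G"
    using edge_verts[OF assms] by (auto simp: nbrs_def)
  show "finite (verts G)"
    using assms by (simp add: finite_simple_graph_def)
qed

lemma incidence_eq: "incidence i e = of_bool (i = snd e) - of_bool (i = fst e)"
  by (cases e) simp

text \<open>Edges ending at \<open>i\<close> count positively and edges starting at \<open>i\<close>
  negatively, which is the net flow into \<open>i\<close>. This turns the kernel condition into a
  sum over neighbors, where the covering property applies.\<close>

lemma sum_incidence_edges: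
  assumes G: "finite_simple_graph G" and E: "orientation G E"
  shows "(\<Sum>e\<in>E. incidence i e * w e) = (\<Sum>j\<in>nbrs G i. skew E w j i)"
proof -
  let ?A = "{j. (j, i) \<in> E}" and ?B = "{j. (i, j) \<in> E}"
  have nbrs: "nbrs G i = ?A \<union> ?B" "?A \<inter> ?B = {}"
    using orientation_total[OF E, of i] orientation_edge[OF E, of i] orientation_edge[OF E, of _ i]
      orientation_asym[OF E]
    by (auto simp: nbrs_def insert_commute[of _ i])
  have fin: "finite E" "finite ?A" "finite ?B"
    using finite_orientation[OF G E] finite_nbrs[OF G, of i] nbrs by auto
  have A: "(\<Sum>j\<in>?A. w (j, i)) = (\<Sum>e\<in>E. of_bool (i = snd e) * w e)"
  proof -
    have "(\<Sum>j\<in>?A. w (j, i)) = (\<Sum>e\<in>{e\<in>E. i = snd e}. w e)"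
      by (rule sum.reindex_bij_witness[of _ fst "\<lambda>j. (j, i)"]) auto
    also have "\<dots> = (\<Sum>e\<in>E. of_bool (i = snd e) * w e)"
      using fin(1) by (intro sum.mono_neutral_cong_left) auto
    finally show ?thesis .
  qed
  have B: "(\<Sum>j\<in>?B. w (i, j)) = (\<Sum>e\<in>E. of_bool (i = fst e) * w e)"
  proof -
    have "(\<Sum>j\<in>?B. w (i, j)) = (\<Sum>e\<in>{e\<in>E. i = fst e}. w e)"
      by (rule sum.reindex_bij_witness[of _ snd "\<lambda>j. (i, j)"]) auto
    also have "\<dots> = (\<Sum>e\<in>E. of_bool (i = fst e) * w e)"
      using fin(1) by (intro sum.mono_neutral_cong_left) auto
    finally show ?thesis .
  qed
  have "(\<Sum>j\<in>nbrs G i. skew E w j i) = (\<Sum>j\<in>?A. skew E w j i) + (\<Sum>j\<in>?B. skew E w j i)"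
    unfolding nbrs(1) by (rule sum.union_disjoint[OF fin(2,3) nbrs(2)])
  also have "(\<Sum>j\<in>?A. skew E w j i) = (\<Sum>j\<in>?A. w (j, i))"
    by (rule sum.cong) (auto simp: skew_def)
  also have "(\<Sum>j\<in>?B. skew E w j i) = (\<Sum>j\<in>?B. - w (i, j))"
    using orientation_asym[OF E] by (intro sum.cong) (auto simp: skew_def)
  finally show ?thesis
    by (simp add: A B sum_negf incidence_eq left_diff_distrib sum_subtractf)
qed

lemma mem_H1_iff:
  "z \<in> H1 G E \<longleftrightarrow> z \<in> rspace E \<and> (\<forall>i\<in>verts G. (\<Sum>e\<in>E. incidence i e * z e) = 0)"
  by (auto simp: H1_def inc_map_def fun_eq_iff restrict_def)

lemma sum_incidence_verts:
  assumes "finite V" "i \<in> V" "j \<in> V"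
  shows "(\<Sum>v\<in>V. incidence v (i, j) * x v) = x j - x i"
proof -
  have "(\<Sum>v\<in>V. of_bool (v = u) * x v) = x u" if "u \<in> V" for u
    using assms(1) that by (simp add: of_bool_def if_distrib[of "\<lambda>c. c * _"] cong: if_cong)
  then show ?thesis
    using assms by (simp add: left_diff_distrib sum_subtractf)
qed

text \<open>The transposed incidence matrix is the discrete gradient. The case \<open>p = q\<close>
  is included for edges that \<phi> collapses.\<close>

lemma skew_inc_transp:
  assumes "finite_simple_graph G" "orientation G E" "{p, q} \<in> edges G \<or> p = q"
  shows "skew E (inc_transp G E y) p q = y q - y p"
proof -
  have apply_edge: "inc_transp G E y (i, j) = y j - y i" if "(i, j) \<in> E" for i j
  proof -
    have "i \<in> verts G" "j \<in> verts G"
      using edge_verts[OF assms(1)] orientation_edge[OF assms(2) that] by auto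
    then show ?thesis
      using assms(1) that sum_incidence_verts[of "verts G" i j y]
      by (simp add: inc_transp_def finite_simple_graph_def)
  qed
  show ?thesis
    using assms(3)
  proof
    assume "{p, q} \<in> edges G"
    then show ?thesis
      using orientation_total[OF assms(2), of p q] by (auto simp: skew_def apply_edge)
  qed (simp add: skew_refl[OF assms(2)])
qed

section \<open>Lifting edges and summing along generalized covering maps\<close>

lemma covering_image: "generalized_covering_map G H \<phi> \<Longrightarrow> \<phi> ` verts G = verts H"
  by (simp add: generalized_covering_map_def)

lemma covering_mapE:
  assumes "generalized_covering_map G H \<phi>" "i \<in> verts G"
  obtains d :: nat where "d \<ge> 1" "\<phi> ` (nbrs G i - \<phi> -` {\<phi> i}) \<subseteq> nbrs H (\<phi> i)"
    "\<And>b. b \<in> nbrs H (\<phi> i) \<Longrightarrow> card {j \<in> nbrs G i - \<phi> -` {\<phi> i}. \<phi> j = b} = d"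
proof -
  have "\<exists>d::nat. d \<ge> 1 \<and> \<phi> ` (nbrs G i - \<phi> -` {\<phi> i}) \<subseteq> nbrs H (\<phi> i) \<and>
      (\<forall>b\<in>nbrs H (\<phi> i). card {j \<in> nbrs G i - \<phi> -` {\<phi> i}. \<phi> j = b} = d)"
    by (rule bspec[OF conjunct2[OF assms(1)[unfolded generalized_covering_map_def]] assms(2)])
  then show ?thesis
    by (elim exE conjE) (rule that, assumption+, erule bspec)
qed

lemma covering_edge:
  assumes "finite_simple_graph G" "generalized_covering_map G H \<phi>" "{i, j} \<in> edges G"
  shows "{\<phi> i, \<phi> j} \<in> edges H \<or> \<phi> i = \<phi> j"
proof (cases "\<phi> i = \<phi> j")
  case False
  have "i \<in> verts G"
    using edge_verts(1)[OF assms(1,3)] .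
  then have "\<phi> ` (nbrs G i - \<phi> -` {\<phi> i}) \<subseteq> nbrs H (\<phi> i)"
    by (rule covering_mapE[OF assms(2)])
  moreover have "j \<in> nbrs G i - \<phi> -` {\<phi> i}"
    using assms(3) False by (simp add: nbrs_def)
  ultimately show ?thesis
    by (auto simp: nbrs_def)
qed simp

text \<open>Surjectivity on vertices provides \<open>i\<close> over \<open>a\<close>, and
  \<open>d \<ge> 1\<close> forces a neighbor of \<open>i\<close> over \<open>b\<close>. Injectivity
  of the induced map rests on this.\<close>

lemma covering_edge_lift:
  assumes "finite_simple_graph H" "generalized_covering_map G H \<phi>" "{a, b} \<in> edges H"
  obtains i j where "{i, j} \<in> edges G" "\<phi> i = a" "\<phi> j = b"
proof -
  have "a \<in> \<phi> ` verts G"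
    unfolding covering_image[OF assms(2)] by (rule edge_verts(1)[OF assms(1,3)])
  then obtain i where i: "i \<in> verts G" "\<phi> i = a"
    by (elim imageE) simp
  have "b \<in> nbrs H (\<phi> i)"
    using assms(3) i by (simp add: nbrs_def)
  moreover obtain d :: nat where "d \<ge> 1"
    "\<And>b. b \<in> nbrs H (\<phi> i) \<Longrightarrow> card {j \<in> nbrs G i - \<phi> -` {\<phi> i}. \<phi> j = b} = d"
    by (rule covering_mapE[OF assms(2) i(1)]) (rule that)
  ultimately have "card {j \<in> nbrs G i - \<phi> -` {\<phi> i}. \<phi> j = b} \<ge> 1"
    by simp
  then have "{j \<in> nbrs G i - \<phi> -` {\<phi> i}. \<phi> j = b} \<noteq> {}"
    by (metis card.empty not_one_le_zero)
  then show ?thesis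
    using that i by (auto simp: nbrs_def)
qed

text \<open>Neighbors in the fiber of \<open>i\<close> contribute \<open>K (\<phi> i) = 0\<close>;
  the others, grouped by their images, meet each neighbor of \<open>\<phi> i\<close> exactly
  \<open>d\<close> times.\<close>

lemma covering_sum:
  assumes G: "finite_simple_graph G" and H: "finite_simple_graph H"
    and cov: "generalized_covering_map G H \<phi>" and i: "i \<in> verts G"
  obtains d :: nat where
    "\<And>K :: _ \<Rightarrow> real. K (\<phi> i) = 0 \<Longrightarrow> (\<Sum>j\<in>nbrs G i. K (\<phi> j)) = d * (\<Sum>b\<in>nbrs H (\<phi> i). K b)"
proof -
  let ?N = "nbrs G i - \<phi> -` {\<phi> i}"
  obtain d where sub: "\<phi> ` ?N \<subseteq> nbrs H (\<phi> i)"
    and card: "\<And>b. b \<in> nbrs H (\<phi> i) \<Longrightarrow> card {j \<in> ?N. \<phi> j = b} = d"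
    by (rule covering_mapE[OF cov i]) (rule that)
  have "(\<Sum>j\<in>nbrs G i. K (\<phi> j)) = d * (\<Sum>b\<in>nbrs H (\<phi> i). K b)" if "K (\<phi> i) = 0" for K :: "_ \<Rightarrow> real"
  proof -
    have "(\<Sum>j\<in>nbrs G i. K (\<phi> j)) = (\<Sum>j\<in>?N. K (\<phi> j))"
      using that by (intro sum.mono_neutral_right finite_nbrs[OF G]) auto
    also have "\<dots> = (\<Sum>b\<in>nbrs H (\<phi> i). \<Sum>j\<in>{j \<in> ?N. \<phi> j = b}. K (\<phi> j))"
      using sub finite_nbrs[OF G] finite_nbrs[OF H] by (intro sum.group[symmetric]) auto
    also have "\<dots> = (\<Sum>b\<in>nbrs H (\<phi> i). d * K b)"
    proof (rule sum.cong)
      fix b assume "b \<in> nbrs H (\<phi> i)"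
      have "(\<Sum>j\<in>{j \<in> ?N. \<phi> j = b}. K (\<phi> j)) = (\<Sum>j\<in>{j \<in> ?N. \<phi> j = b}. K b)"
        by (rule sum.cong) auto
      then show "(\<Sum>j\<in>{j \<in> ?N. \<phi> j = b}. K (\<phi> j)) = d * K b"
        using card[OF \<open>b \<in> nbrs H (\<phi> i)\<close>] by simp
    qed simp
    finally show ?thesis
      by (simp add: sum_distrib_left)
  qed
  then show ?thesis
    by (rule that)
qed

section \<open>The induced map on edge values\<close>

text \<open>Applying \<open>skew\<close> to the constant 1 gives the relative orientation: 1 or -1
  if the image pair is an edge with matching or reversed orientation, and 0 if it is no
  edge.\<close>

definition edge_sign :: "('w \<times> 'w) set \<Rightarrow> ('v \<Rightarrow> 'w) \<Rightarrow> 'v \<times> 'v \<Rightarrow> real" where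
  "edge_sign E \<phi> = (\<lambda>(i, j). skew E (\<lambda>_. 1) (\<phi> i) (\<phi> j))"

text \<open>When the image pair is no edge, the second branch is only a default value, and
  \<open>edge_sign\<close> is 0 there.\<close>

definition edge_image :: "('w \<times> 'w) set \<Rightarrow> ('v \<Rightarrow> 'w) \<Rightarrow> 'v \<times> 'v \<Rightarrow> 'w \<times> 'w" where
  "edge_image E \<phi> = (\<lambda>(i, j). if (\<phi> i, \<phi> j) \<in> E then (\<phi> i, \<phi> j) else (\<phi> j, \<phi> i))"

abbreviation edge_pullback ::
    "('v \<times> 'v) set \<Rightarrow> ('w \<times> 'w) set \<Rightarrow> ('v \<Rightarrow> 'w) \<Rightarrow> ('w \<times> 'w \<Rightarrow> real) \<Rightarrow> ('v \<times> 'v \<Rightarrow> real)" where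
  "edge_pullback E\<^sub>G E\<^sub>H \<phi> \<equiv> coord_map E\<^sub>G (edge_sign E\<^sub>H \<phi>) (edge_image E\<^sub>H \<phi>)"

lemma edge_pullback_apply:
  "(i, j) \<in> E\<^sub>G \<Longrightarrow> edge_pullback E\<^sub>G E\<^sub>H \<phi> z (i, j) = skew E\<^sub>H z (\<phi> i) (\<phi> j)"
  by (simp add: coord_map_def edge_sign_def edge_image_def skew_def)

lemma skew_edge_pullback:
  assumes "orientation G E\<^sub>G" "orientation H E\<^sub>H" "{i, j} \<in> edges G"
  shows "skew E\<^sub>G (edge_pullback E\<^sub>G E\<^sub>H \<phi> z) i j = skew E\<^sub>H z (\<phi> i) (\<phi> j)"
  using orientation_total[OF assms(1,3)] skew_antisym[OF assms(2), of z "\<phi> i" "\<phi> j"]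
  by (auto simp: skew_def[of E\<^sub>G] edge_pullback_apply)

text \<open>Every edge of \<open>H\<close> lifts to an edge of \<open>G\<close>, and one of the two
  directions of the lift belongs to the orientation of \<open>G\<close>.\<close>

lemma covering_coords_edge_pullback:
  assumes "finite_simple_graph H" and oG: "orientation G E\<^sub>G" and oH: "orientation H E\<^sub>H"
    and "generalized_covering_map G H \<phi>"
  shows "covering_coords E\<^sub>H E\<^sub>G (edge_sign E\<^sub>H \<phi>) (edge_image E\<^sub>H \<phi>)"
  unfolding covering_coords_def
proof (intro conjI ballI)
  fix g
  show "edge_sign E\<^sub>H \<phi> g \<in> {- 1, 0, 1}"
    by (auto simp: edge_sign_def skew_def split: prod.splits)
  show "edge_sign E\<^sub>H \<phi> g \<noteq> 0 \<longrightarrow> edge_image E\<^sub>H \<phi> g \<in> E\<^sub>H"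
    by (auto simp: edge_sign_def edge_image_def skew_def split: prod.splits)
next
  fix e assume "e \<in> E\<^sub>H"
  moreover obtain a b where e: "e = (a, b)"
    by (cases e)
  ultimately have ab: "(a, b) \<in> E\<^sub>H" "(b, a) \<notin> E\<^sub>H" "{a, b} \<in> edges H"
    using orientation_asym[OF oH] orientation_edge[OF oH] by auto
  obtain i j where ij: "{i, j} \<in> edges G" "\<phi> i = a" "\<phi> j = b"
    using covering_edge_lift[OF assms(1,4) ab(3)] by metis
  from orientation_total[OF oG ij(1)]
  show "\<exists>g\<in>E\<^sub>G. edge_sign E\<^sub>H \<phi> g \<noteq> 0 \<and> edge_image E\<^sub>H \<phi> g = e"
  proof
    assume "(i, j) \<in> E\<^sub>G"
    then show ?thesis
      using ab ij e by (intro bexI[of _ "(i, j)"]) (auto simp: edge_sign_def edge_image_def skew_def)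
  next
    assume "(j, i) \<in> E\<^sub>G"
    then show ?thesis
      using ab ij e by (intro bexI[of _ "(j, i)"]) (auto simp: edge_sign_def edge_image_def skew_def)
  qed
qed

text \<open>The net flow into \<open>i\<close> is a multiple of the net flow into
  \<open>\<phi> i\<close>, which is zero. \<open>covering_sum\<close> applies because
  \<open>skew\<close> vanishes on the diagonal.\<close>

lemma edge_pullback_H1_odd:
  assumes G: "finite_simple_graph G" and H: "finite_simple_graph H"
    and oG: "orientation G E\<^sub>G" and oH: "orientation H E\<^sub>H"
    and cov: "generalized_covering_map G H \<phi>" and odd: "\<forall>x. f (- x) = - f x"
    and z: "(\<lambda>e\<in>E\<^sub>H. f (z e)) \<in> H1 H E\<^sub>H"
  shows "(\<lambda>e\<in>E\<^sub>G. f (edge_pullback E\<^sub>G E\<^sub>H \<phi> z e)) \<in> H1 G E\<^sub>G"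
  unfolding mem_H1_iff
proof (intro conjI ballI)
  fix i assume i: "i \<in> verts G"
  let ?F = "\<lambda>e\<in>E\<^sub>G. f (edge_pullback E\<^sub>G E\<^sub>H \<phi> z e)"
  define K where "K b = skew E\<^sub>H (\<lambda>e\<in>E\<^sub>H. f (z e)) b (\<phi> i)" for b
  obtain d :: nat where
    d: "K (\<phi> i) = 0 \<Longrightarrow> (\<Sum>j\<in>nbrs G i. K (\<phi> j)) = d * (\<Sum>b\<in>nbrs H (\<phi> i). K b)"
    using covering_sum[OF G H cov i] by metis
  have "\<phi> i \<in> verts H"
    using covering_image[OF cov] i by blast
  then have "(\<Sum>b\<in>nbrs H (\<phi> i). K b) = 0"
    using z unfolding mem_H1_iff sum_incidence_edges[OF H oH] K_def by blast
  moreover have "(\<Sum>e\<in>E\<^sub>G. incidence i e * ?F e) = (\<Sum>j\<in>nbrs G i. K (\<phi> j))"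
    unfolding sum_incidence_edges[OF G oG]
  proof (rule sum.cong)
    fix j assume "j \<in> nbrs G i"
    then have "{j, i} \<in> edges G"
      by (simp add: nbrs_def insert_commute)
    then show "skew E\<^sub>G ?F j i = K (\<phi> j)"
      by (simp only: K_def skew_odd[OF odd] skew_edge_pullback[OF oG oH])
  qed simp
  ultimately show "(\<Sum>e\<in>E\<^sub>G. incidence i e * ?F e) = 0"
    using d skew_refl[OF oH] by (simp add: K_def)
qed simp

text \<open>The transpose of the pullback pushes cycles of \<open>G\<close> forward to cycles of \<open>H\<close>.\<close>

lemma edge_pullback_H1_perp:
  assumes G: "finite_simple_graph G" and H: "finite_simple_graph H"
    and oG: "orientation G E\<^sub>G" and oH: "orientation H E\<^sub>H"
    and cov: "generalized_covering_map G H \<phi>"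
    and z: "z \<in> H1_perp H E\<^sub>H"
  shows "edge_pullback E\<^sub>G E\<^sub>H \<phi> z \<in> H1_perp G E\<^sub>G"
  unfolding H1_perp_def mem_Collect_eq
proof (intro conjI ballI)
  show "edge_pullback E\<^sub>G E\<^sub>H \<phi> z \<in> rspace E\<^sub>G"
    by (rule coord_map_in_rspace)
  fix w assume w: "w \<in> H1 G E\<^sub>G"
  note fin = finite_orientation[OF G oG] finite_orientation[OF H oH]
  have finV: "finite (verts G)"
    using G by (simp add: finite_simple_graph_def)
  \<comment> \<open>\<open>c e g\<close> is the matrix entry of the pullback for the edge
    \<open>e\<close> of \<open>H\<close> and the edge \<open>g\<close> of \<open>G\<close>;
    \<open>u\<close> is the transposed matrix applied to the cycle \<open>w\<close>.\<close>
  define c where "c e g = skew E\<^sub>H (\<lambda>e'. of_bool (e' = e)) (\<phi> (fst g)) (\<phi> (snd g))" for e g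
  define u where "u = (\<lambda>e\<in>E\<^sub>H. \<Sum>g\<in>E\<^sub>G. w g * c e g)"
  \<comment> \<open>This is the adjunction between pullback and transpose. It is used for the
    incidence rows of \<open>H\<close>, to see that \<open>u\<close> is a cycle, and finally for
    \<open>z\<close>.\<close>
  have expand: "(\<Sum>e\<in>E\<^sub>H. y e * u e) = (\<Sum>g\<in>E\<^sub>G. skew E\<^sub>H y (\<phi> (fst g)) (\<phi> (snd g)) * w g)" for y
  proof -
    have "(\<Sum>e\<in>E\<^sub>H. y e * u e) = (\<Sum>e\<in>E\<^sub>H. \<Sum>g\<in>E\<^sub>G. y e * c e g * w g)"
      by (simp add: u_def sum_distrib_left ac_simps)
    also have "\<dots> = (\<Sum>g\<in>E\<^sub>G. (\<Sum>e\<in>E\<^sub>H. y e * c e g) * w g)"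
      by (subst sum.swap) (simp add: sum_distrib_right)
    finally show ?thesis
      by (simp add: c_def flip: skew_expand[OF fin(2)])
  qed
  have "u \<in> H1 H E\<^sub>H"
    unfolding mem_H1_iff
  proof (intro conjI ballI)
    fix v assume "v \<in> verts H"
    let ?F = "{k \<in> verts G. \<phi> k = v}"
    \<comment> \<open>The incidence row of \<open>v\<close> pulls back to the sum of the rows over
      its fiber. On a collapsed edge both sides vanish, since its endpoints lie in one
      fiber.\<close>
    have "skew E\<^sub>H (incidence v) (\<phi> i) (\<phi> j) = (\<Sum>k\<in>?F. incidence k (i, j))"
      if "(i, j) \<in> E\<^sub>G" for i j
    proof -
      have edge: "{i, j} \<in> edges G" and ij: "i \<in> verts G" "j \<in> verts G"
        using orientation_edge[OF oG that] edge_verts[OF G] by auto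
      have "skew E\<^sub>H (incidence v) (\<phi> i) (\<phi> j) = of_bool (v = \<phi> j) - of_bool (v = \<phi> i)"
        using covering_edge[OF G cov edge] orientation_total[OF oH, of "\<phi> i" "\<phi> j"]
          skew_refl[OF oH] by (auto simp: skew_def)
      \<comment> \<open>The difference is the discrete gradient of the indicator of the fiber over
        \<open>v\<close>.\<close>
      also have "\<dots> = (\<Sum>k\<in>verts G. incidence k (i, j) * of_bool (\<phi> k = v))"
        by (simp only: sum_incidence_verts[OF finV ij]) auto
      also have "\<dots> = (\<Sum>k\<in>?F. incidence k (i, j))"
        using finV by (intro sum.mono_neutral_cong_right) auto
      finally show ?thesis .
    qed
    then have "(\<Sum>e\<in>E\<^sub>H. incidence v e * u e) = (\<Sum>g\<in>E\<^sub>G. (\<Sum>k\<in>?F. incidence k g) * w g)"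
      unfolding expand by (intro sum.cong) auto
    also have "\<dots> = (\<Sum>k\<in>?F. \<Sum>g\<in>E\<^sub>G. incidence k g * w g)"
      by (simp only: sum_distrib_right) (rule sum.swap)
    also have "\<dots> = 0"
      using w by (simp add: mem_H1_iff)
    finally show "(\<Sum>e\<in>E\<^sub>H. incidence v e * u e) = 0" .
  qed (simp add: u_def)
  then have "(\<Sum>e\<in>E\<^sub>H. z e * u e) = 0"
    using z by (simp add: H1_perp_def)
  moreover have "edge_pullback E\<^sub>G E\<^sub>H \<phi> z g = skew E\<^sub>H z (\<phi> (fst g)) (\<phi> (snd g))" if "g \<in> E\<^sub>G" for g
    using that by (cases g) (simp add: edge_pullback_apply)
  ultimately show "(\<Sum>g\<in>E\<^sub>G. edge_pullback E\<^sub>G E\<^sub>H \<phi> z g * w g) = 0"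
    by (simp add: expand)
qed

lemma edge_pullback_equilibria_mod:
  assumes "finite_simple_graph G" "finite_simple_graph H"
    and "orientation G E\<^sub>G" "orientation H E\<^sub>H"
    and "generalized_covering_map G H \<phi>" "\<forall>x. f (- x) = - f x"
  shows "edge_pullback E\<^sub>G E\<^sub>H \<phi> ` equilibria_mod H E\<^sub>H f \<subseteq> equilibria_mod G E\<^sub>G f"
proof (rule image_subsetI)
  fix z assume "z \<in> equilibria_mod H E\<^sub>H f"
  then have "(\<lambda>e\<in>E\<^sub>H. f (z e)) \<in> H1 H E\<^sub>H" "z \<in> H1_perp H E\<^sub>H"
    by (simp_all add: equilibria_mod_def)
  from edge_pullback_H1_odd[OF assms this(1)] edge_pullback_H1_perp[OF assms(1-5) this(2)]
  show "edge_pullback E\<^sub>G E\<^sub>H \<phi> z \<in> equilibria_mod G E\<^sub>G f"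
    unfolding equilibria_mod_def by (intro IntI CollectI conjI coord_map_in_rspace)
qed

section \<open>Compatibility with equilibria on the vertices\<close>

text \<open>The fiber count is applied to the interaction terms
  \<open>f (y b - y (\<phi> i))\<close>; the term at \<open>b = \<phi> i\<close> is
  \<open>f 0 = 0\<close>, as the count demands.\<close>

lemma pullback_equilibria:
  assumes G: "finite_simple_graph G" and H: "finite_simple_graph H"
    and cov: "generalized_covering_map G H \<phi>" and "f 0 = 0"
    and y: "y \<in> equilibria H f"
  shows "pullback G \<phi> y \<in> equilibria G f"
  unfolding equilibria_def mem_Collect_eq
proof (intro conjI ballI)
  fix i assume i: "i \<in> verts G"
  define K where "K b = f (y b - y (\<phi> i))" for b
  obtain d :: nat where
    d: "K (\<phi> i) = 0 \<Longrightarrow> (\<Sum>j\<in>nbrs G i. K (\<phi> j)) = d * (\<Sum>b\<in>nbrs H (\<phi> i). K b)"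
    using covering_sum[OF G H cov i] by metis
  have "\<phi> i \<in> verts H"
    using covering_image[OF cov] i by blast
  then have "(\<Sum>b\<in>nbrs H (\<phi> i). K b) = 0"
    using y by (simp add: equilibria_def K_def)
  moreover have "(\<Sum>j\<in>nbrs G i. f (pullback G \<phi> y j - pullback G \<phi> y i)) = (\<Sum>j\<in>nbrs G i. K (\<phi> j))"
  proof (rule sum.cong)
    fix j assume "j \<in> nbrs G i"
    then have "j \<in> verts G"
      using edge_verts(2)[OF G] by (auto simp: nbrs_def)
    then show "f (pullback G \<phi> y j - pullback G \<phi> y i) = K (\<phi> j)"
      using i by (simp add: pullback_def K_def)
  qed simp
  ultimately show "(\<Sum>j\<in>nbrs G i. f (pullback G \<phi> y j - pullback G \<phi> y i)) = 0"
    using d \<open>f 0 = 0\<close> by (simp add: K_def)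
qed (simp add: pullback_def)

text \<open>On an edge from \<open>i\<close> to \<open>j\<close> both sides equal
  \<open>y (\<phi> j) - y (\<phi> i)\<close>, which is 0 if the edge is collapsed.\<close>

lemma edge_pullback_inc_transp:
  assumes G: "finite_simple_graph G" and H: "finite_simple_graph H"
    and oG: "orientation G E\<^sub>G" and oH: "orientation H E\<^sub>H"
    and cov: "generalized_covering_map G H \<phi>"
  shows "edge_pullback E\<^sub>G E\<^sub>H \<phi> (inc_transp H E\<^sub>H y) = inc_transp G E\<^sub>G (pullback G \<phi> y)"
proof (rule PiE_ext[OF coord_map_in_rspace])
  show "inc_transp G E\<^sub>G (pullback G \<phi> y) \<in> rspace E\<^sub>G"
    by (simp add: inc_transp_def)
  fix g assume "g \<in> E\<^sub>G"
  moreover obtain i j where g: "g = (i, j)"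
    by (cases g)
  ultimately have ij: "(i, j) \<in> E\<^sub>G" and edge: "{i, j} \<in> edges G"
    using orientation_edge[OF oG] by auto
  have "edge_pullback E\<^sub>G E\<^sub>H \<phi> (inc_transp H E\<^sub>H y) (i, j) = y (\<phi> j) - y (\<phi> i)"
    using skew_inc_transp[OF H oH] covering_edge[OF G cov edge]
    by (simp add: edge_pullback_apply[OF ij])
  also have "\<dots> = pullback G \<phi> y j - pullback G \<phi> y i"
    using edge_verts[OF G edge] by (simp add: pullback_def)
  also have "\<dots> = skew E\<^sub>G (inc_transp G E\<^sub>G (pullback G \<phi> y)) i j"
    using edge by (simp add: skew_inc_transp[OF G oG])
  also have "\<dots> = inc_transp G E\<^sub>G (pullback G \<phi> y) (i, j)"
    using ij by (simp add: skew_def)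
  finally show "edge_pullback E\<^sub>G E\<^sub>H \<phi> (inc_transp H E\<^sub>H y) g = inc_transp G E\<^sub>G (pullback G \<phi> y) g"
    by (simp add: g)
qed

theorem theorem3p14:
  fixes G :: "'v ugraph" and H :: "'w ugraph"
    and E\<^sub>G :: "('v \<times> 'v) set" and E\<^sub>H :: "('w \<times> 'w) set"
    and f :: "real \<Rightarrow> real" and \<phi> :: "'v \<Rightarrow> 'w"
  assumes "finite_simple_graph G" and "finite_simple_graph H"
    and "orientation G E\<^sub>G" and "orientation H E\<^sub>H"
    and "real_analytic f" and "\<forall>x. f (- x) = - f x" and "\<exists>x y. f x \<noteq> f y"
    and "generalized_covering_map G H \<phi>"
  shows "(\<exists>\<Phi>. induced_by_pullback G E\<^sub>G H E\<^sub>H f \<phi> \<Phi> \<and>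
            analytic_embedding E\<^sub>H (equilibria_mod H E\<^sub>H f) E\<^sub>G (equilibria_mod G E\<^sub>G f) \<Phi>) \<and>
         analytic_dim E\<^sub>G (equilibria_mod G E\<^sub>G f) \<ge> analytic_dim E\<^sub>H (equilibria_mod H E\<^sub>H f)"
proof -
  let ?\<Phi> = "edge_pullback E\<^sub>G E\<^sub>H \<phi>"
  let ?X = "equilibria_mod H E\<^sub>H f"
  note fin = finite_orientation[OF assms(1,3)] finite_orientation[OF assms(2,4)]
  have cov: "covering_coords E\<^sub>H E\<^sub>G (edge_sign E\<^sub>H \<phi>) (edge_image E\<^sub>H \<phi>)"
    by (rule covering_coords_edge_pullback[OF assms(2-4,8)])
  have maps: "?\<Phi> ` ?X \<subseteq> equilibria_mod G E\<^sub>G f"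
    by (rule edge_pullback_equilibria_mod[OF assms(1-4,8,6)])
  have "f 0 = 0"
    using spec[OF assms(6), of 0] by simp
  then have "induced_by_pullback G E\<^sub>G H E\<^sub>H f \<phi> ?\<Phi>"
    using pullback_equilibria[OF assms(1,2,8)] edge_pullback_inc_transp[OF assms(1-4,8)]
    by (simp add: induced_by_pullback_def)
  moreover have "?X \<subseteq> rspace E\<^sub>H"
    unfolding equilibria_mod_def by blast
  \<comment> \<open>The identity embedding of the equilibria is composed with the signed coordinate
    map; the codomain, so far the image, is enlarged afterwards.\<close>
  then have "analytic_embedding E\<^sub>H ?X E\<^sub>G (?\<Phi> ` ?X) (?\<Phi> \<circ> id)"
    by (intro analytic_embedding_coord_map[OF analytic_embedding_id] fin cov)
  then have "analytic_embedding E\<^sub>H ?X E\<^sub>G (equilibria_mod G E\<^sub>G f) ?\<Phi>"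
    using analytic_embedding_codomain[OF _ maps] by simp
  ultimately show ?thesis
    using analytic_dim_coord_map_le[OF fin(1) cov maps] by blast
qed

end
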